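(* Let $0<q<1$, $l>0$, $\nu\in\mathbb R$ and $\lambda=\frac{\nu}{2(1-q)}$. For the operator $$I_3=-\frac12\,q^{-3J_0/4}(J_++J_-)q^{-3J_0/4}+\frac{1+q}{2(1-q)}\,q^{-2J_0}-\frac{q^l+q^{1-l}}{2(1-q)}\,q^{-J_0},$$ the eigenfunctions $I_3\,\zeta^l_\lambda=\lambda\,\zeta^l_\lambda$ are $$\zeta^l_\lambda(x;q)=\sum_{n=0}^\infty P_n(\lambda)f^l_n(x;q)=\frac{1}{(q^{(3-2l)/4}x;q)_\infty}\;{}_1\phi_1\bigl(-\nu;\,0;\,q;\,q^{3(1+2l)/4}x\bigr),$$ where $P_n(\lambda)=q^{n/2}\frac{(q;q)_n^{1/2}}{(q^{2l};q)_n^{1/2}}\,L_n^{(2l-1)}(2(1-q)\lambda;q)$ and $L_n^{(\alpha)}(\cdot\,;q)$ are the $q$-Laguerre polynomials.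
   Context: Notation: $(a;q)_n=\prod_{r=0}^{n-1}(1-aq^r)$, $(a;q)_\infty=\prod_{r\ge0}(1-aq^r)$, $[c]_q=\frac{q^{c/2}-q^{-c/2}}{q^{1/2}-q^{-1/2}}$, and ${}_1\phi_1(a;0;q;z)=\sum_{k\ge0}\frac{(a;q)_k}{(q;q)_k}(-1)^kq^{k(k-1)/2}z^k$. Discrete series representation $T_l^+$ of $U_q(\mathrm{su}_{1,1})$ ($l>0$): $\mathcal H_l$ is the Hilbert space with orthonormal basis the monomials $f^l_n(x;q)=c^l_n(q)x^n$, $n=0,1,2,\dots$, where $c^l_n(q)=q^{(1-2l)n/4}\left(\frac{(q^{2l};q)_n}{(q;q)_n}\right)^{1/2}$. The operators act by $J_0f^l_n=(l+n)f^l_n$, $J_+f^l_n=\sqrt{[2l+n]_q[n+1]_q}\,f^l_{n+1}$, $J_-f^l_n=\sqrt{[2l+n-1]_q[n]_q}\,f^l_{n-1}$, and $q^{cJ_0}f^l_n=q^{c(l+n)}f^l_n$. The operator $I_3$ is tridiagonal in this basis and hence acts coefficientwise on formal power series $\sum_na_nf^l_n$; the eigenvalue equation is understood for this action, eigenfunctions being determined up to a constant factor and normalized to have value $1$ at $x=0$. $q$-Laguerre polynomials: $L_n^{(\alpha)}(y;q)=\frac{(q^{\alpha+1};q)_n}{(q;q)_n}\sum_{k=0}^n\frac{(q^{-n};q)_k\,y^k}{(q^{\alpha+1};q)_k(q;q)_k}\,q^{k[n+\alpha+(k+1)/2]}$. *)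

theory Defs
  imports "HOL-Analysis.Analysis"
begin

definition qpoch :: "'a::comm_ring_1 \<Rightarrow> 'a \<Rightarrow> nat \<Rightarrow> 'a" where
  "qpoch a q n = (\<Prod>r<n. 1 - a * q ^ r)"

definition qpoch_inf :: "complex \<Rightarrow> complex \<Rightarrow> complex" where
  "qpoch_inf a q = (\<Prod>r. 1 - a * q ^ r)"

definition qnum :: "real \<Rightarrow> real \<Rightarrow> real" where
  "qnum q c = (q powr (c / 2) - q powr (- c / 2)) / (q powr (1 / 2) - q powr (- 1 / 2))"

definition phi11 :: "complex \<Rightarrow> complex \<Rightarrow> complex \<Rightarrow> complex \<Rightarrow> complex" where
  "phi11 a b q z =
     (\<Sum>k. qpoch a q k / (qpoch b q k * qpoch q q k) * (-1) ^ k * q ^ (k * (k - 1) div 2) * z ^ k)"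

definition qLaguerre :: "real \<Rightarrow> nat \<Rightarrow> real \<Rightarrow> real \<Rightarrow> real" where
  "qLaguerre \<alpha> n y q =
     qpoch (q powr (\<alpha> + 1)) q n / qpoch q q n *
     (\<Sum>k\<le>n. qpoch (q powr (- real n)) q k * y ^ k /
             (qpoch (q powr (\<alpha> + 1)) q k * qpoch q q k) *
             q powr (real k * (real n + \<alpha> + (real k + 1) / 2)))"

definition basis_const :: "real \<Rightarrow> real \<Rightarrow> nat \<Rightarrow> real" where
  "basis_const q l n =
     q powr ((1 - 2 * l) * real n / 4) * sqrt (qpoch (q powr (2 * l)) q n / qpoch q q n)"

definition basis_fun :: "real \<Rightarrow> real \<Rightarrow> nat \<Rightarrow> complex \<Rightarrow> complex" where
  "basis_fun q l n x = of_real (basis_const q l n) * x ^ n"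

text \<open>The formal power series in \<open>x\<close> given by \<open>\<Sum>n. a n * f n\<close>, where \<open>f n\<close> is the
  monomial \<open>basis_fun q l n\<close>, and conversely the coefficients of a formal power series
  with respect to these monomials.\<close>

definition basis_series :: "real \<Rightarrow> real \<Rightarrow> (nat \<Rightarrow> complex) \<Rightarrow> complex fps" where
  "basis_series q l a = Abs_fps (\<lambda>n. a n * of_real (basis_const q l n))"

definition basis_coeff :: "real \<Rightarrow> real \<Rightarrow> complex fps \<Rightarrow> nat \<Rightarrow> complex" where
  "basis_coeff q l \<phi> n = fps_nth \<phi> n / of_real (basis_const q l n)"

text \<open>The operators are the coefficientwise extensions to formal power series of their action on
  the basis; this action is recovered in the lemmas \<open>qJ0_basis\<close>, \<open>J_plus_basis\<close>,
  \<open>J_minus_basis_0\<close> and \<open>J_minus_basis_Suc\<close> below. \<open>qJ0 q l c\<close> is the operator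
  \<open>q\<close> to the power \<open>c J\<^sub>0\<close>.\<close>

definition qJ0 :: "real \<Rightarrow> real \<Rightarrow> real \<Rightarrow> complex fps \<Rightarrow> complex fps" where
  "qJ0 q l c \<phi> = basis_series q l (\<lambda>n. of_real (q powr (c * (l + real n))) * basis_coeff q l \<phi> n)"

definition J_plus :: "real \<Rightarrow> real \<Rightarrow> complex fps \<Rightarrow> complex fps" where
  "J_plus q l \<phi> = basis_series q l (\<lambda>n. case n of 0 \<Rightarrow> 0
     | Suc m \<Rightarrow> of_real (sqrt (qnum q (2 * l + real m) * qnum q (real m + 1))) * basis_coeff q l \<phi> m)"

definition J_minus :: "real \<Rightarrow> real \<Rightarrow> complex fps \<Rightarrow> complex fps" where
  "J_minus q l \<phi> = basis_series q l (\<lambda>n.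
     of_real (sqrt (qnum q (2 * l + real (Suc n) - 1) * qnum q (real (Suc n)))) * basis_coeff q l \<phi> (Suc n))"

definition I3 :: "real \<Rightarrow> real \<Rightarrow> complex fps \<Rightarrow> complex fps" where
  "I3 q l \<phi> =
     - fps_const (1 / 2) * qJ0 q l (- 3 / 4)
         (J_plus q l (qJ0 q l (- 3 / 4) \<phi>) + J_minus q l (qJ0 q l (- 3 / 4) \<phi>))
     + fps_const (of_real ((1 + q) / (2 * (1 - q)))) * qJ0 q l (- 2) \<phi>
     - fps_const (of_real ((q powr l + q powr (1 - l)) / (2 * (1 - q)))) * qJ0 q l (- 1) \<phi>"

definition P_coeff :: "real \<Rightarrow> real \<Rightarrow> nat \<Rightarrow> real \<Rightarrow> real" where
  "P_coeff q l n lam =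
     q powr (real n / 2) * (sqrt (qpoch q q n) / sqrt (qpoch (q powr (2 * l)) q n)) *
     qLaguerre (2 * l - 1) n (2 * (1 - q) * lam) q"

definition zeta :: "real \<Rightarrow> real \<Rightarrow> real \<Rightarrow> complex fps" where
  "zeta q l lam = basis_series q l (\<lambda>n. of_real (P_coeff q l n lam))"

lemma qpoch_pos:
  assumes "0 < q" "q < 1" "0 < a" "a < (1::real)"
  shows "qpoch a q n > 0"
  unfolding qpoch_def
proof (rule prod_pos, safe)
  fix r
  have "a * q ^ r \<le> a * 1"
    using assms by (intro mult_left_mono power_le_one) auto
  with assms show "0 < 1 - a * q ^ r" by linarith
qed

lemma basis_const_pos:
  assumes "0 < q" "q < 1" "0 < l"
  shows "basis_const q l n > 0"
proof -
  have "q powr (2 * l) < 1" using assms powr_less_mono2[of "2 * l" q 1] by simp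
  then show ?thesis unfolding basis_const_def using assms
    by (intro mult_pos_pos) (auto intro!: divide_pos_pos qpoch_pos)
qed

abbreviation basis_vec :: "real \<Rightarrow> real \<Rightarrow> nat \<Rightarrow> complex fps" where
  "basis_vec q l n \<equiv> fps_const (of_real (basis_const q l n)) * fps_X ^ n"

lemma basis_coeff_vec:
  assumes "0 < q" "q < 1" "0 < l"
  shows "basis_coeff q l (basis_vec q l n) m = (if m = n then 1 else 0)"
  using basis_const_pos[OF assms, of n] by (simp add: basis_coeff_def)

lemma qJ0_basis:
  assumes "0 < q" "q < 1" "0 < l"
  shows "qJ0 q l c (basis_vec q l n) =
    fps_const (of_real (q powr (c * (l + real n)))) * basis_vec q l n"
  by (rule fps_ext) (simp add: qJ0_def basis_series_def basis_coeff_vec[OF assms])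

lemma J_plus_basis:
  assumes "0 < q" "q < 1" "0 < l"
  shows "J_plus q l (basis_vec q l n) =
    fps_const (of_real (sqrt (qnum q (2 * l + real n) * qnum q (real n + 1)))) * basis_vec q l (Suc n)"
  by (rule fps_ext)
    (simp add: J_plus_def basis_series_def basis_coeff_vec[OF assms] fps_X_power_nth
        del: power_Suc split: nat.split)

lemma J_minus_basis_0:
  assumes "0 < q" "q < 1" "0 < l"
  shows "J_minus q l (basis_vec q l 0) = 0"
  by (rule fps_ext) (simp only: J_minus_def basis_series_def basis_coeff_vec[OF assms] fps_nth_Abs_fps, simp)

lemma J_minus_basis_Suc:
  assumes "0 < q" "q < 1" "0 < l"
  shows "J_minus q l (basis_vec q l (Suc n)) =
    fps_const (of_real (sqrt (qnum q (2 * l + real (Suc n) - 1) * qnum q (real (Suc n))))) * basis_vec q l n"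
  by (rule fps_ext)
    (simp only: J_minus_def basis_series_def basis_coeff_vec[OF assms] fps_nth_Abs_fps, simp)

end

(* Put A = q^{2l}, t = q^{(3-2l)/4} x, and write a power series as the sum of u_n t^n. Then the
   eigenvalue equation of I_3 becomes a three-term recurrence for u_n, which determines u_n from
   u_0 because 1 - q^{n+1} is never 0. The q-Laguerre polynomials satisfy this recurrence, as one
   sees by comparing coefficients of powers of nu. So do the Taylor coefficients of the product of
   1/(t;q)_oo and F(t) = 1phi1(-nu;0;q;At): write D for the dilation t -> qt, which is a ring
   homomorphism; 1/(t;q)_oo is multiplied by 1 - t under D, and
   F - DF = -At (DF + nu D^2 F), which gives a q-difference equation for the product. *)
theory Submission
  imports Defs
begin

section \<open>Finite q-shifted factorials and the three-term recurrence\<close>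

lemma qpoch_0 [simp]: "qpoch a q 0 = 1"
  by (simp add: qpoch_def)

lemma qpoch_Suc: "qpoch a q (Suc n) = qpoch a q n * (1 - a * q ^ n)"
  by (simp add: qpoch_def)

lemma qpoch_zero [simp]: "qpoch 0 q n = 1"
  by (simp add: qpoch_def)

lemma qpoch_of_real: "qpoch (of_real a :: 'a::real_field) (of_real q) n = of_real (qpoch a q n)"
  by (simp add: qpoch_def)

text \<open>This is the recurrence of the q-Laguerre polynomials in the variable \<open>y\<close>,
  with \<open>A\<close> standing for q^(alpha+1). The \<open>case\<close> drops the term of index
  -1. The field is left general because the polynomials are real while the coefficients of the power
  series are complex.\<close>

definition qlag_rec :: "'a::field \<Rightarrow> 'a \<Rightarrow> 'a \<Rightarrow> (nat \<Rightarrow> 'a) \<Rightarrow> bool" where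
  "qlag_rec q A y u \<longleftrightarrow> (\<forall>n. (1 - q ^ Suc n) * u (Suc n) =
     (1 + q - q ^ Suc n - A * q ^ n - y * A * q ^ (2 * n)) * u n
       - (case n of 0 \<Rightarrow> 0 | Suc m \<Rightarrow> q * (1 - A * q ^ m) * u m))"

text \<open>Each new term is fixed by the two before it, as the leading factor can be cancelled.
  Since the recurrence is linear, a solution is its initial value times the normalized one.\<close>

lemma qlag_rec_unique:
  fixes q :: "'a::field"
  assumes u: "qlag_rec q A y u" and v: "qlag_rec q A y v" and "v 0 = 1"
    and q: "\<And>n. q ^ Suc n \<noteq> 1"
  shows "u n = u 0 * v n"
proof (induction n rule: less_induct)
  case (less n)
  show ?case
  proof (cases n)
    case 0
    then show ?thesis using \<open>v 0 = 1\<close> by simp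
  next
    case (Suc m)
    let ?b = "1 + q - q ^ Suc m - A * q ^ m - y * A * q ^ (2 * m)"
    \<comment> \<open>For \<open>m = 0\<close> both sides are 0, so the truncated index
      \<open>m - 1\<close> matters only when \<open>m\<close> is a successor.\<close>
    have "(case m of 0 \<Rightarrow> 0 | Suc k \<Rightarrow> q * (1 - A * q ^ k) * u k) =
        u 0 * (case m of 0 \<Rightarrow> 0 | Suc k \<Rightarrow> q * (1 - A * q ^ k) * v k)"
      using less[of "m - 1"] Suc by (auto split: nat.split)
    moreover have "u m = u 0 * v m" using less[of m] Suc by simp
    moreover have "(1 - q ^ Suc m) * u (Suc m) = ?b * u m
        - (case m of 0 \<Rightarrow> 0 | Suc k \<Rightarrow> q * (1 - A * q ^ k) * u k)"
      using u unfolding qlag_rec_def by blast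
    moreover have "(1 - q ^ Suc m) * v (Suc m) = ?b * v m
        - (case m of 0 \<Rightarrow> 0 | Suc k \<Rightarrow> q * (1 - A * q ^ k) * v k)"
      using v unfolding qlag_rec_def by blast
    ultimately have "(1 - q ^ Suc m) * u (Suc m) = (1 - q ^ Suc m) * (u 0 * v (Suc m))"
      by (simp only: right_diff_distrib mult.left_commute[of _ "u 0"])
    then show ?thesis using q[of m] Suc by simp
  qed
qed

lemma qlag_rec_scale:
  assumes "qlag_rec q A y u"
  shows "qlag_rec q A y (\<lambda>n. c * u n)"
  unfolding qlag_rec_def
proof
  fix n
  have "(1 - q ^ Suc n) * u (Suc n) = (1 + q - q ^ Suc n - A * q ^ n - y * A * q ^ (2 * n)) * u n
       - (case n of 0 \<Rightarrow> 0 | Suc m \<Rightarrow> q * (1 - A * q ^ m) * u m)"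
    using assms unfolding qlag_rec_def by blast
  then have "c * ((1 - q ^ Suc n) * u (Suc n)) =
    c * ((1 + q - q ^ Suc n - A * q ^ n - y * A * q ^ (2 * n)) * u n
       - (case n of 0 \<Rightarrow> 0 | Suc m \<Rightarrow> q * (1 - A * q ^ m) * u m))" by simp
  then show "(1 - q ^ Suc n) * (c * u (Suc n)) =
     (1 + q - q ^ Suc n - A * q ^ n - y * A * q ^ (2 * n)) * (c * u n)
       - (case n of 0 \<Rightarrow> 0 | Suc m \<Rightarrow> q * (1 - A * q ^ m) * (c * u m))"
    by (cases n) (simp_all only: nat.case right_diff_distrib mult.left_commute[of c] diff_0_right mult_zero_right)
qed

lemma qlag_rec_of_real:
  assumes "qlag_rec q A y u"
  shows "qlag_rec (of_real q :: 'a::real_field) (of_real A) (of_real y) (\<lambda>n. of_real (u n))"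
  unfolding qlag_rec_def
proof
  fix n
  have "(1 - q ^ Suc n) * u (Suc n) = (1 + q - q ^ Suc n - A * q ^ n - y * A * q ^ (2 * n)) * u n
       - (case n of 0 \<Rightarrow> 0 | Suc m \<Rightarrow> q * (1 - A * q ^ m) * u m)"
    using assms unfolding qlag_rec_def by blast
  from arg_cong[OF this, of "of_real :: real \<Rightarrow> 'a"]
  show "(1 - of_real q ^ Suc n) * of_real (u (Suc n) ) =
     (1 + of_real q - of_real q ^ Suc n - of_real A * of_real q ^ n - of_real y * of_real A * of_real q ^ (2 * n)) * of_real (u n)
       - (case n of 0 \<Rightarrow> 0 | Suc m \<Rightarrow> (of_real q :: 'a) * (1 - of_real A * of_real q ^ m) * of_real (u m))"
    by (cases n) simp_all
qed

section \<open>q-Laguerre polynomials\<close>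

lemma triangular_Suc: "Suc k * (Suc k - 1) div 2 = k * (k - 1) div 2 + k"
  by (cases k) (simp_all add: algebra_simps)

text \<open>Multiplying the factor 1 - q^(r-n) by q^n gives -q^r (1 - q^(n-r)). The product over r <
  k therefore yields the sign, the triangular power of q and the quotient of (q;q)_n by (q;q)_(n-k),
  which is stated here without division.\<close>

lemma qpoch_qinv:
  fixes q :: real
  assumes "0 < q" "q < 1" "k \<le> n"
  shows "qpoch (q powr (- real n)) q k * q powr (real k * real n) * qpoch q q (n - k) =
    (-1) ^ k * q ^ (k * (k - 1) div 2) * qpoch q q n"
  using assms(3)
proof (induction k)
  case (Suc k)
  have nk: "n - k = Suc (n - Suc k)" using Suc.prems by simp
  have a: "qpoch q q (n - k) = qpoch q q (n - Suc k) * (1 - q ^ (n - k))"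
    unfolding nk qpoch_Suc by simp
  have c: "q powr (- real n) * q ^ k * q powr (real n) = q ^ k"
    using assms by (simp add: powr_minus field_simps)
  have b: "(1 - q powr (- real n) * q ^ k) * q powr (real n) = - (q ^ k) * (1 - q ^ (n - k))"
    using assms Suc.prems c by (simp add: algebra_simps powr_realpow flip: power_add)
  have "qpoch (q powr (- real n)) q (Suc k) * q powr (real (Suc k) * real n) * qpoch q q (n - Suc k)
     = qpoch (q powr (- real n)) q k * q powr (real k * real n) *
       ((1 - q powr (- real n) * q ^ k) * q powr (real n)) * qpoch q q (n - Suc k)"
    by (simp add: qpoch_Suc algebra_simps powr_add)
  also have "\<dots> = - (q ^ k) * (qpoch (q powr (- real n)) q k * q powr (real k * real n) * qpoch q q (n - k))"
    unfolding b a by (simp add: algebra_simps)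
  also have "\<dots> = - (q ^ k) * ((-1) ^ k * q ^ (k * (k - 1) div 2) * qpoch q q n)"
    using Suc by simp
  also have "\<dots> = (-1) ^ Suc k * q ^ (Suc k * (Suc k - 1) div 2) * qpoch q q n"
    unfolding triangular_Suc by (simp add: power_add)
  finally show ?case .
qed (use assms(1) in simp)

text \<open>Splitting the power of q in the definition as q^(kn) A^k q^(k(k-1)/2) lets the first
  factor be absorbed by (q^(-n);q)_k. After that, \<open>n\<close> enters the k-th summand only
  through (q;q)_(n-k), which is the form suited to comparing different \<open>n\<close>.\<close>

lemma qLaguerre_eq:
  fixes q \<alpha> y :: real
  defines "A \<equiv> q powr (\<alpha> + 1)"
  assumes q: "0 < q" "q < 1" and "\<alpha> > -1"
  shows "qLaguerre \<alpha> n y q = qpoch A q n *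
    (\<Sum>k\<le>n. q ^ (k * (k - 1)) * (- y * A) ^ k / (qpoch A q k * qpoch q q k) / qpoch q q (n - k))"
proof -
  have A: "0 < A" "A < 1" unfolding A_def using q assms powr_less_mono2[of "\<alpha> + 1" q 1] by auto
  have nz: "qpoch q q m \<noteq> 0" for m using qpoch_pos[OF q q, of m] by simp
  have "qLaguerre \<alpha> n y q = qpoch A q n / qpoch q q n * (\<Sum>k\<le>n. qpoch q q n *
    (q ^ (k * (k - 1)) * (- y * A) ^ k / (qpoch A q k * qpoch q q k) / qpoch q q (n - k)))"
    unfolding qLaguerre_def A_def[symmetric]
  proof (rule arg_cong[where f = "\<lambda>s. _ * s"], rule sum.cong)
    fix k assume "k \<in> {..n}"
    then have kn: "k \<le> n" by simp
    \<comment> \<open>Evenness makes the integer division by 2 exact, so that the real exponent in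
      the definition can be matched with natural powers of \<open>q\<close>.\<close>
    have "even (k * (k - 1))" by (cases k) simp_all
    then have e2: "2 * (k * (k - 1) div 2) = k * (k - 1)" by (rule dvd_mult_div_cancel)
    have "real (k * (k - 1)) = 2 * real (k * (k - 1) div 2)"
      by (subst e2[symmetric]) simp
    then have h: "real k * real k = 2 * real (k * (k - 1) div 2) + real k"
      by (cases k) (auto simp: algebra_simps)
    have "real k * (real n + \<alpha> + (real k + 1) / 2) =
        real k * real n + (\<alpha> + 1) * real k + real (k * (k - 1) div 2)"
      using h by (simp add: algebra_simps)
    then have p: "q powr (real k * (real n + \<alpha> + (real k + 1) / 2)) =
        q powr (real k * real n) * A ^ k * q ^ (k * (k - 1) div 2)"
      using q by (simp add: powr_add powr_realpow A_def powr_powr[symmetric])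
    have s: "q ^ (k * (k - 1) div 2) * q ^ (k * (k - 1) div 2) = q ^ (k * (k - 1))"
      by (subst e2[symmetric]) (simp only: mult_2 power_add)
    have sgn: "(- y * A) ^ k = (-1) ^ k * y ^ k * A ^ k"
      by (simp flip: power_mult_distrib)
    have inv: "qpoch (q powr (- real n)) q k * q powr (real k * real n)
        = (-1) ^ k * q ^ (k * (k - 1) div 2) * qpoch q q n / qpoch q q (n - k)"
      using qpoch_qinv[OF q kn] nz[of "n - k"] by (simp add: field_simps)
    have "qpoch (q powr (- real n)) q k * q powr (real k * (real n + \<alpha> + (real k + 1) / 2)) =
       (qpoch (q powr (- real n)) q k * q powr (real k * real n)) * (A ^ k * q ^ (k * (k - 1) div 2))"
      unfolding p by (simp only: mult_ac)
    then have "qpoch (q powr (- real n)) q k * q powr (real k * (real n + \<alpha> + (real k + 1) / 2)) =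
       (-1) ^ k * A ^ k * (q ^ (k * (k - 1) div 2) * q ^ (k * (k - 1) div 2)) * qpoch q q n / qpoch q q (n - k)"
      unfolding inv by (simp add: mult_ac)
    then have m: "qpoch (q powr (- real n)) q k * q powr (real k * (real n + \<alpha> + (real k + 1) / 2)) =
       (-1) ^ k * A ^ k * q ^ (k * (k - 1)) * qpoch q q n / qpoch q q (n - k)"
      unfolding s .
    have "qpoch (q powr (- real n)) q k * y ^ k / (qpoch A q k * qpoch q q k) *
             q powr (real k * (real n + \<alpha> + (real k + 1) / 2)) =
          (qpoch (q powr (- real n)) q k * q powr (real k * (real n + \<alpha> + (real k + 1) / 2)))
            * y ^ k / (qpoch A q k * qpoch q q k)"
      by simp
    also have "\<dots> = qpoch q q n *
      (q ^ (k * (k - 1)) * (- y * A) ^ k / (qpoch A q k * qpoch q q k) / qpoch q q (n - k))"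
      unfolding m sgn by (simp add: mult_ac)
    finally show "qpoch (q powr (- real n)) q k * y ^ k / (qpoch A q k * qpoch q q k) *
             q powr (real k * (real n + \<alpha> + (real k + 1) / 2)) = qpoch q q n *
      (q ^ (k * (k - 1)) * (- y * A) ^ k / (qpoch A q k * qpoch q q k) / qpoch q q (n - k))" .
  qed simp
  then show ?thesis using nz[of n] by (simp only: sum_distrib_left[symmetric]) simp
qed

text \<open>The factor (A;q)_n is split off, and the recurrence for the remaining sum
  \<open>S n\<close> is checked one power of \<open>y\<close> at a time.\<close>

lemma qLaguerre_rec:
  assumes q: "0 < q" "q < 1" and "\<alpha> > -1"
  shows "qlag_rec q (q powr (\<alpha> + 1)) y (\<lambda>n. qLaguerre \<alpha> n y q)"
proof -
  define A where "A = q powr (\<alpha> + 1)"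
  have A: "0 < A" "A < 1" unfolding A_def using q assms powr_less_mono2[of "\<alpha> + 1" q 1] by auto
  have nz: "qpoch q q m \<noteq> 0" "qpoch A q m \<noteq> 0" for m
    using qpoch_pos[OF q q, of m] qpoch_pos[OF q A, of m] by simp_all
  define d where "d k = q ^ (k * (k - 1)) * (- y * A) ^ k / (qpoch A q k * qpoch q q k)" for k
  \<comment> \<open>Reading 1/(q;q)_(n-k) as 0 for k > n lets the sums of three consecutive indices
    run over the same range.\<close>
  define w where "w n k = (if k \<le> n then 1 / qpoch q q (n - k) else 0)" for n k
  define S where "S n = (\<Sum>k\<le>n. d k * w n k)" for n
  have L: "qLaguerre \<alpha> n y q = qpoch A q n * S n" for n
    unfolding qLaguerre_eq[OF q \<open>\<alpha> > -1\<close>] S_def A_def[symmetric]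
    by (intro arg_cong[where f = "\<lambda>s. _ * s"] sum.cong) (auto simp: d_def w_def)
  have S_ext: "S n = (\<Sum>k\<le>N. d k * w n k)" if "n \<le> N" for n N
    unfolding S_def using that by (intro sum.mono_neutral_left) (auto simp: w_def)
  have w_Suc: "w n k * (1 - q ^ (n - k)) = (if k < n then w (n - 1) k else 0)" if "k \<le> n" for n k
  proof (cases "k < n")
    case True
    then have "n - k = Suc (n - 1 - k)" by simp
    moreover have "1 - q * q ^ (n - 1 - k) \<noteq> 0" using power_Suc_less_one[of q "n - 1 - k"] q by simp
    ultimately show ?thesis using True nz(1)[of "n - 1 - k"] by (simp add: w_def qpoch_Suc)
  qed (use that in simp)
  \<comment> \<open>Multiplication by \<open>y\<close> raises the power by one; this relation turns
    the term with \<open>d (k - 1)\<close> back into a multiple of \<open>d k\<close>.\<close>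
  have d_Suc: "d (Suc k) * ((1 - A * q ^ k) * (1 - q ^ Suc k)) = - y * A * q ^ (2 * k) * d k" for k
  proof -
    have e: "Suc k * (Suc k - 1) = k * (k - 1) + 2 * k" by (cases k) simp_all
    have n1: "1 - A * q ^ k \<noteq> 0" using nz(2)[of "Suc k"] by (simp add: qpoch_Suc)
    have n2: "1 - q * q ^ k \<noteq> 0" using nz(1)[of "Suc k"] by (simp add: qpoch_Suc)
    have gen: "(a * b) * (s * t) / ((g * u) * (h * v)) * (u * v) = s * b * (a * t / (g * h))"
      if "u \<noteq> 0" "v \<noteq> 0" for a b s t g h u v :: real
      using that by simp
    show ?thesis
      unfolding d_def e qpoch_Suc power_Suc power_add by (rule gen[OF n1 n2])
  qed
  have key: "(1 - q ^ Suc n) * (1 - A * q ^ n) * (d k * w (Suc n) k) =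
      (1 + q - q ^ Suc n - A * q ^ n) * (d k * w n k)
      - y * A * q ^ (2 * n) * (case k of 0 \<Rightarrow> 0 | Suc j \<Rightarrow> d j * w n j)
      - q * (case n of 0 \<Rightarrow> 0 | Suc m \<Rightarrow> d k * w m k)" if "k \<le> Suc n" for n k
  proof -
    define W where "W = w (Suc n) k"
    \<comment> \<open>Lowering the index of the weight from n+1 to n multiplies it by 1 - R, and
      from n to n-1 by 1 - R/q, while \<open>w n (k - 1)\<close> is \<open>W\<close> itself. So all
      weights are multiples of \<open>W\<close>. At k = n+1 one has R = 1, which agrees with the
      convention that \<open>w n k\<close> is 0.\<close>
    define R where "R = q ^ (Suc n - k)"
    have K: "R * q ^ k = q ^ Suc n" unfolding R_def using that by (simp only: flip: power_add) simp
    have w0: "w n k = W * (1 - R)"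
      using w_Suc[OF that] that unfolding W_def R_def by (auto simp: w_def)
    have w1: "q * (case n of 0 \<Rightarrow> 0 | Suc m \<Rightarrow> d k * w m k) = d k * (W * (1 - R) * (q - R))"
    proof (cases "k \<le> n")
      case True
      then have R: "R = q * q ^ (n - k)" by (simp add: R_def Suc_diff_le)
      have "w n k * (q - R) = q * (w n k * (1 - q ^ (n - k)))" by (simp add: R algebra_simps)
      also have "\<dots> = q * (case n of 0 \<Rightarrow> 0 | Suc m \<Rightarrow> w m k)"
        unfolding w_Suc[OF True] using True by (auto split: nat.split simp: w_def)
      finally show ?thesis unfolding w0[symmetric] by (cases n) auto
    next
      case False
      then show ?thesis using that w0 by (auto split: nat.split simp: w_def R_def)
    qed
    have w2: "- y * A * q ^ (2 * n) * (case k of 0 \<Rightarrow> 0 | Suc j \<Rightarrow> d j * w n j)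
        = W * d k * (R * (R - A * q ^ n) * (1 - q ^ k))"
    proof (cases k)
      case (Suc j)
      have jn: "j \<le> n" using that Suc by simp
      have w: "w n j = W" using jn Suc by (simp add: W_def w_def)
      have R: "q ^ n = R * q ^ j" using jn by (simp add: R_def Suc flip: power_add)
      have "- y * A * q ^ (2 * n) * (d j * w n j) = R\<^sup>2 * (- y * A * q ^ (2 * j) * d j) * W"
        unfolding w power_mult power2_eq_square mult_2 power_add R by simp
      also have "\<dots> = R\<^sup>2 * (d k * ((1 - A * q ^ j) * (1 - q ^ k))) * W"
        unfolding d_Suc[symmetric] Suc by simp
      also have "\<dots> = W * d k * (R * (R - A * q ^ n) * (1 - q ^ k))"
        unfolding R by (simp add: power2_eq_square algebra_simps)
      finally show ?thesis by (simp add: Suc)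
    qed simp
    \<comment> \<open>With K = q^k and B = A q^n, what remains after removing the factor
      \<open>W * d k\<close> is a polynomial identity.\<close>
    have id: "(1 - R * K) * (1 - B) = (1 + q - R * K - B) * (1 - R) + R * (R - B) * (1 - K) - (1 - R) * (q - R)"
      if "B * q = A * (R * K)" for B K
      by (simp add: algebra_simps)
    show ?thesis
      using arg_cong[OF id[of "A * q ^ n" "q ^ k"], of "\<lambda>s. W * d k * s"]
      unfolding w0 w1 K W_def[symmetric]
      using w2 by (simp add: algebra_simps)
  qed
  have S_rec: "(1 - q ^ Suc n) * (1 - A * q ^ n) * S (Suc n) =
      (1 + q - q ^ Suc n - A * q ^ n - y * A * q ^ (2 * n)) * S n
      - q * (case n of 0 \<Rightarrow> 0 | Suc m \<Rightarrow> S m)" for n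
  proof -
    have "(1 - q ^ Suc n) * (1 - A * q ^ n) * S (Suc n) =
      (\<Sum>k\<le>Suc n. (1 - q ^ Suc n) * (1 - A * q ^ n) * (d k * w (Suc n) k))"
      by (simp only: S_def sum_distrib_left)
    also have "\<dots> = (\<Sum>k\<le>Suc n. (1 + q - q ^ Suc n - A * q ^ n) * (d k * w n k)
      - y * A * q ^ (2 * n) * (case k of 0 \<Rightarrow> 0 | Suc j \<Rightarrow> d j * w n j)
      - q * (case n of 0 \<Rightarrow> 0 | Suc m \<Rightarrow> d k * w m k))"
      by (intro sum.cong refl key) simp
    also have "\<dots> = (1 + q - q ^ Suc n - A * q ^ n) * (\<Sum>k\<le>Suc n. d k * w n k)
      - y * A * q ^ (2 * n) * (\<Sum>k\<le>Suc n. case k of 0 \<Rightarrow> 0 | Suc j \<Rightarrow> d j * w n j)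
      - q * (\<Sum>k\<le>Suc n. case n of 0 \<Rightarrow> 0 | Suc m \<Rightarrow> d k * w m k)"
      by (simp only: sum_subtractf sum_distrib_left)
    \<comment> \<open>The term k = 0 vanishes, so shifting the index by one recovers
      \<open>S n\<close>.\<close>
    also have "(\<Sum>k\<le>Suc n. case k of 0 \<Rightarrow> 0 | Suc j \<Rightarrow> d j * w n j) = S n"
      unfolding S_def by (subst sum.atMost_Suc_shift) simp
    also have "(\<Sum>k\<le>Suc n. d k * w n k) = S n" by (rule S_ext[symmetric]) simp
    also have "(\<Sum>k\<le>Suc n. case n of 0 \<Rightarrow> 0 | Suc m \<Rightarrow> d k * w m k) = (case n of 0 \<Rightarrow> 0 | Suc m \<Rightarrow> S m)"
      using S_ext[of "n - 1" "Suc n"] by (cases n) auto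
    finally show ?thesis by (simp add: algebra_simps)
  qed
  show ?thesis unfolding qlag_rec_def A_def[symmetric] L
  proof
    fix n
    \<comment> \<open>Restoring (A;q)_n moves the factor 1 - A q^n, which stands before
      \<open>S (Suc n)\<close>, into (A;q)_(n+1), and produces the factor 1 - A q^m in the last
      term.\<close>
    have "(case n of 0 \<Rightarrow> 0 | Suc m \<Rightarrow> q * (1 - A * q ^ m) * (qpoch A q m * S m)) =
      qpoch A q n * (q * (case n of 0 \<Rightarrow> 0 | Suc m \<Rightarrow> S m))"
      by (cases n) (simp_all add: qpoch_Suc)
    then show "(1 - q ^ Suc n) * (qpoch A q (Suc n) * S (Suc n)) =
         (1 + q - q ^ Suc n - A * q ^ n - y * A * q ^ (2 * n)) * (qpoch A q n * S n) -
         (case n of 0 \<Rightarrow> 0 | Suc m \<Rightarrow> q * (1 - A * q ^ m) * (qpoch A q m * S m))"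
      using arg_cong[OF S_rec[of n], of "\<lambda>s. qpoch A q n * s"]
      by (simp only: qpoch_Suc) (simp only: algebra_simps)
  qed
qed

section \<open>The generating function\<close>

text \<open>The sequences \<open>e\<close> and \<open>b\<close> stand for the coefficients of
  1/(t;q)_oo and of 1phi1(-y;0;q;At), each known only through its first-order recurrence. The
  argument is formal, so questions of convergence stay separate.\<close>

lemma qlag_rec_cauchy:
  fixes q A y :: "'a::field" and e b :: "nat \<Rightarrow> 'a"
  assumes e: "\<And>n. (1 - q ^ Suc n) * e (Suc n) = e n"
    and b: "\<And>n. (1 - q ^ Suc n) * b (Suc n) = - A * q ^ n * (1 + y * q ^ n) * b n"
  shows "qlag_rec q A y (\<lambda>n. \<Sum>k\<le>n. b k * e (n - k))"
proof -
  \<comment> \<open>Writing the dilation as composition with qX gives its multiplicativity from that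
    of composition.\<close>
  define D where "D f = fps_compose f (fps_const q * fps_X)" for f :: "'a fps"
  have D_nth: "fps_nth (D f) n = q ^ n * fps_nth f n" for f n
    unfolding D_def by (simp add: fps_compose_linear)
  have D_mult: "D (f * g) = D f * D g" for f g
    unfolding D_def by (rule fps_compose_mult_distrib) simp
  define E where "E = Abs_fps e"
  define B where "B = Abs_fps b"
  define G where "G = B * E"
  define p where "p = 1 - (fps_X :: 'a fps)"
  define r where "r = 1 - fps_const q * (fps_X :: 'a fps)"
  have DE: "D E = p * E"
  proof (rule fps_ext)
    fix n show "fps_nth (D E) n = fps_nth (p * E) n"
      using e[of "n - 1"] by (cases n) (simp_all add: D_nth E_def p_def algebra_simps)
  qed
  have Dp: "D p = r"
    unfolding p_def r_def D_def by (simp add: fps_compose_sub_distrib)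
  have DB: "B = D B - fps_const A * fps_X * (D B + fps_const y * D (D B))"
  proof (rule fps_ext)
    fix n show "fps_nth B n = fps_nth (D B - fps_const A * fps_X * (D B + fps_const y * D (D B))) n"
      using b[of "n - 1"] by (cases n) (simp_all add: D_nth B_def mult.assoc algebra_simps)
  qed
  have DG: "D G = p * E * D B" unfolding G_def D_mult DE by (simp add: mult_ac)
  have DDG: "D (D G) = r * p * E * D (D B)" unfolding DG D_mult Dp DE by (simp add: mult_ac)
  \<comment> \<open>The factors \<open>p\<close> and \<open>r\<close> are those that
    \<open>E\<close> acquires under \<open>D\<close> and \<open>D\<close> twice. Multiplying by both
    makes every term a multiple of \<open>G\<close>, \<open>D G\<close> or \<open>D (D G)\<close>,
    which eliminates \<open>E\<close> and \<open>B\<close>.\<close>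
  have "r * p * G = r * p * E * B" by (simp add: G_def mult_ac)
  also have "\<dots> = r * p * E * (D B - fps_const A * fps_X * (D B + fps_const y * D (D B)))"
    by (subst DB) simp
  also have "\<dots> = r * D G - fps_const A * fps_X * (r * D G + fps_const y * D (D G))"
    unfolding DDG unfolding DG by (simp add: algebra_simps)
  finally have eq: "r * p * G = r * D G - fps_const A * fps_X * (r * D G + fps_const y * D (D G))" .
  have G_nth: "fps_nth G n = (\<Sum>k\<le>n. b k * e (n - k))" for n
    by (simp add: G_def fps_mult_nth B_def E_def atLeast0AtMost)
  have "qlag_rec q A y (\<lambda>n. fps_nth G n)"
    unfolding qlag_rec_def
  proof
    fix n
    have r_nth: "fps_nth (r * f) (Suc m) = fps_nth f (Suc m) - q * fps_nth f m" "fps_nth (r * f) 0 = fps_nth f 0" for f m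
      by (simp_all add: r_def left_diff_distrib mult.assoc)
    have p_nth: "fps_nth (p * f) (Suc m) = fps_nth f (Suc m) - fps_nth f m" "fps_nth (p * f) 0 = fps_nth f 0" for f m
      by (simp_all add: p_def left_diff_distrib)
    have ax: "fps_nth (fps_const A * fps_X * f) (Suc m) = A * fps_nth f m" for f m
      by (simp add: mult.assoc)
    have sq: "q ^ (2 * n) = q ^ n * q ^ n" by (simp add: mult_2 power_add)
    \<comment> \<open>The coefficient of X^(n+1) is the recurrence at \<open>n\<close>: the factor
      AX lowers the index by one, so \<open>D (D G)\<close> contributes q^(2n) times the n-th
      coefficient.\<close>
    have "fps_nth (r * p * G) (Suc n) = fps_nth (r * D G - fps_const A * fps_X * (r * D G + fps_const y * D (D G))) (Suc n)"
      using eq by simp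
    then show "(1 - q ^ Suc n) * fps_nth G (Suc n) = (1 + q - q ^ Suc n - A * q ^ n - y * A * q ^ (2 * n)) * fps_nth G n
       - (case n of 0 \<Rightarrow> 0 | Suc m \<Rightarrow> q * (1 - A * q ^ m) * fps_nth G m)"
      unfolding mult.assoc[of r p] fps_sub_nth fps_add_nth fps_mult_left_const_nth ax sq
      by (cases n) (simp_all only: nat.case r_nth p_nth D_nth, simp_all add: algebra_simps)
  qed
  then show ?thesis unfolding G_nth .
qed

section \<open>Convergence and Euler's sum for 1/(t;q)_oo\<close>

text \<open>The ratio is supplied as a multiplier \<open>c n\<close> and not as a quotient of terms,
  so series with vanishing terms, such as a terminating 1phi1, are covered.\<close>

lemma summable_ratio_tendsto:
  fixes f c :: "nat \<Rightarrow> 'a::{real_normed_field,banach}"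
  assumes f: "\<And>n. f (Suc n) = c n * f n" and c: "c \<longlonglongrightarrow> L" and "norm L < 1"
  shows "summable (\<lambda>n. norm (f n))"
proof -
  obtain r where r: "norm L < r" "r < 1" using dense \<open>norm L < 1\<close> by blast
  have "(\<lambda>n. norm (c n)) \<longlonglongrightarrow> norm L" using c by (rule tendsto_norm)
  then have "eventually (\<lambda>n. norm (c n) < r) sequentially" using r(1) by (rule order_tendstoD)
  then obtain N where N: "\<And>n. n \<ge> N \<Longrightarrow> norm (c n) < r" unfolding eventually_sequentially by blast
  show ?thesis
  proof (rule summable_ratio_test[OF r(2)])
    fix n assume "n \<ge> N"
    then show "norm (norm (f (Suc n))) \<le> r * norm (norm (f n))"
      using N[of n] by (simp add: f norm_mult mult_right_mono)
  qed
qed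

lemma qexp_summable:
  fixes q :: real and t :: complex
  assumes q: "0 < q" "q < 1" and t: "norm t < 1"
  shows "summable (\<lambda>n. norm (t ^ n / of_real (qpoch q q n)))"
proof (rule summable_ratio_tendsto)
  show "t ^ Suc n / of_real (qpoch q q (Suc n)) =
      t / of_real (1 - q * q ^ n) * (t ^ n / of_real (qpoch q q n))" for n
    by (simp add: qpoch_Suc)
  have "(\<lambda>n. t / of_real (1 - q * q ^ n)) \<longlonglongrightarrow> t / of_real (1 - q * 0)"
    using q by (intro tendsto_intros LIMSEQ_power_zero) auto
  then show "(\<lambda>n. t / of_real (1 - q * q ^ n)) \<longlonglongrightarrow> t" by simp
qed (rule t)

text \<open>Comparison with a geometric series gives absolute convergence of the product, and this
  ties the infinite product to its finite truncations.\<close>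

lemma qpoch_inf_LIMSEQ:
  fixes t q :: complex
  assumes "norm q < 1"
  shows "(\<lambda>n. qpoch t q n) \<longlonglongrightarrow> qpoch_inf t q"
proof -
  have "summable (\<lambda>n. norm t * norm q ^ n)"
    using assms by (intro summable_mult summable_geometric) simp
  then have "abs_convergent_prod (\<lambda>n. 1 - t * q ^ n)"
    by (intro summable_imp_abs_convergent_prod) (simp add: norm_mult norm_power)
  then have "(\<lambda>n. \<Prod>i\<le>n. 1 - t * q ^ i) \<longlonglongrightarrow> qpoch_inf t q"
    unfolding qpoch_inf_def
    by (intro convergent_prod_LIMSEQ abs_convergent_prod_imp_convergent_prod)
  then show ?thesis unfolding qpoch_def by (simp add: LIMSEQ_lessThan_iff_atMost)
qed

text \<open>Euler's identity. The sum satisfies S(qz) = (1 - z) S(z); iterating gives S(q^n t) =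
  S(t) (t;q)_n, and continuity at 0 with S(0) = 1 yields S(t) (t;q)_oo = 1 in the limit.\<close>

lemma qexp_suminf:
  fixes q :: real and t :: complex
  assumes q: "0 < q" "q < 1" and t: "norm t < 1"
  shows "(\<Sum>n. t ^ n / of_real (qpoch q q n)) = 1 / qpoch_inf t (of_real q)"
proof -
  define a where "a n = 1 / complex_of_real (qpoch q q n)" for n
  define S where "S z = (\<Sum>n. a n * z ^ n)" for z
  have sm: "summable (\<lambda>n. a n * z ^ n)" if "norm z < 1" for z
    using summable_norm_cancel[OF qexp_summable[OF q that]] by (simp add: a_def)
  have a_Suc: "a (Suc n) * (1 - of_real q ^ Suc n) = a n" for n
  proof -
    have "complex_of_real (1 - q * q ^ n) \<noteq> 0"
      using power_Suc_less_one[of q n] q by (simp only: of_real_eq_0_iff) simp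
    then show ?thesis by (simp add: a_def qpoch_Suc)
  qed
  have qn: "norm (of_real q * z) < 1" if "norm z < 1" for z :: complex
    using mult_strict_mono'[of q 1 "norm z" 1] q that by (simp add: norm_mult)
  have S_step: "S (of_real q * z) = S z * (1 - z)" if z: "norm z < 1" for z
  proof -
    have "S z - S (of_real q * z) = (\<Sum>n. a n * z ^ n - a n * (of_real q * z) ^ n)"
      unfolding S_def by (rule suminf_diff[OF sm[OF z] sm[OF qn[OF z]]])
    \<comment> \<open>The constant terms of the two series cancel, so the sum may start at index
      1.\<close>
    also have "\<dots> = (\<Sum>n. a (Suc n) * z ^ Suc n - a (Suc n) * (of_real q * z) ^ Suc n)"
      using suminf_split_head[OF summable_diff[OF sm[OF z] sm[OF qn[OF z]]]] by simp
    also have "\<dots> = (\<Sum>n. z * (a n * z ^ n))"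
    proof (rule suminf_cong)
      fix n
      have "a (Suc n) * z ^ Suc n - a (Suc n) * (of_real q * z) ^ Suc n
          = a (Suc n) * (1 - of_real q ^ Suc n) * z ^ Suc n"
        unfolding power_mult_distrib by (simp add: algebra_simps)
      then show "a (Suc n) * z ^ Suc n - a (Suc n) * (of_real q * z) ^ Suc n = z * (a n * z ^ n)"
        unfolding a_Suc by simp
    qed
    also have "\<dots> = z * S z" unfolding S_def by (rule suminf_mult[OF sm[OF z]])
    finally show ?thesis by (simp add: algebra_simps)
  qed
  have S_pow: "norm (of_real q ^ n * t) < 1 \<and> S (of_real q ^ n * t) = S t * qpoch t (of_real q) n" for n
  proof (induction n)
    case (Suc n)
    then show ?case using qn[of "of_real q ^ n * t"] S_step[of "of_real q ^ n * t"]
      by (simp add: qpoch_Suc mult_ac)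
  qed (simp add: t)
  \<comment> \<open>Continuity at 0 follows from convergence at any point of larger modulus; 1/2 is
    one inside the unit disc.\<close>
  have "summable (\<lambda>n. a n * (1 / 2) ^ n)" by (rule sm) simp
  then have "isCont (\<lambda>z. \<Sum>n. a n * z ^ n) 0" by (rule isCont_powser) simp
  then have "isCont S 0" unfolding S_def[abs_def] .
  moreover have "(\<lambda>n. of_real q ^ n * t) \<longlonglongrightarrow> 0"
    using q by (intro tendsto_mult_left_zero LIMSEQ_power_zero) simp
  ultimately have "(\<lambda>n. S (of_real q ^ n * t)) \<longlonglongrightarrow> S 0" by (rule isCont_tendsto_compose)
  moreover have "S 0 = 1" unfolding S_def using powser_zero[of a] by (simp add: a_def)
  ultimately have "(\<lambda>n. S t * qpoch t (of_real q) n) \<longlonglongrightarrow> 1" using S_pow by simp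
  moreover have "(\<lambda>n. S t * qpoch t (of_real q) n) \<longlonglongrightarrow> S t * qpoch_inf t (of_real q)"
    using q by (intro tendsto_mult_left qpoch_inf_LIMSEQ) simp
  ultimately have "S t * qpoch_inf t (of_real q) = 1" using LIMSEQ_unique by blast
  \<comment> \<open>The product being 1, neither factor is 0, which justifies the division.\<close>
  then have "S t = 1 / qpoch_inf t (of_real q)"
    by (metis mult_zero_right nonzero_eq_divide_eq zero_neq_one)
  then show ?thesis by (simp add: S_def a_def)
qed

text \<open>By uniqueness \<open>u\<close> consists of the formal product coefficients, and absolute
  convergence turns the formal product into a product of sums. The bound on \<open>t\<close> is what
  Euler's series requires.\<close>

lemma qlag_rec_generating_function:
  fixes q A y :: real and u :: "nat \<Rightarrow> real" and t :: complex
  assumes q: "0 < q" "q < 1" and u: "qlag_rec q A y u" "u 0 = 1" and t: "norm t < 1"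
  shows "(\<lambda>n. of_real (u n) * t ^ n) sums
    (1 / qpoch_inf t (of_real q) * phi11 (of_real (- y)) 0 (of_real q) (of_real A * t))"
proof -
  have q1: "1 - q * q ^ n \<noteq> 0" for n using power_Suc_less_one[of q n] q by simp
  define e where "e n = 1 / qpoch q q n" for n
  define b where "b k = qpoch (- y) q k / qpoch q q k * (- 1) ^ k * q ^ (k * (k - 1) div 2) * A ^ k" for k
  have e_Suc: "(1 - q ^ Suc n) * e (Suc n) = e n" for n
    using q1[of n] by (simp add: e_def qpoch_Suc)
  have b_Suc: "b (Suc n) = - A * q ^ n * (1 + y * q ^ n) / (1 - q * q ^ n) * b n" for n
    unfolding b_def triangular_Suc by (simp add: qpoch_Suc power_add mult_ac)
  then have b_Suc': "(1 - q ^ Suc n) * b (Suc n) = - A * q ^ n * (1 + y * q ^ n) * b n" for n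
    using q1[of n] by simp
  define g where "g n = (\<Sum>k\<le>n. b k * e (n - k))" for n
  have "qlag_rec q A y g"
    unfolding g_def[abs_def] using e_Suc b_Suc' by (rule qlag_rec_cauchy)
  moreover have "g 0 = 1" by (simp add: g_def b_def e_def)
  ultimately have ug: "u n = g n" for n
    using qlag_rec_unique[OF u(1), of g n] u(2) q1 by simp
  let ?e = "\<lambda>n. t ^ n / of_real (qpoch q q n)" and ?b = "\<lambda>k. of_real (b k) * t ^ k"
  have "summable (\<lambda>k. norm (?b k))"
  proof (rule summable_ratio_tendsto)
    show "?b (Suc n) = of_real (- A * q ^ n * (1 + y * q ^ n) / (1 - q * q ^ n)) * t * ?b n" for n
      unfolding b_Suc by simp
    \<comment> \<open>The factor q^n sends the ratio to 0, so the 1phi1 series converges for every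
      \<open>t\<close>.\<close>
    have "(\<lambda>n. of_real (- A * q ^ n * (1 + y * q ^ n) / (1 - q * q ^ n)) * t)
        \<longlonglongrightarrow> of_real (- A * 0 * (1 + y * 0) / (1 - q * 0)) * t"
      using q by (intro tendsto_intros LIMSEQ_power_zero) auto
    then show "(\<lambda>n. of_real (- A * q ^ n * (1 + y * q ^ n) / (1 - q * q ^ n)) * t) \<longlonglongrightarrow> 0" by simp
  qed simp
  from Cauchy_product_sums[OF this qexp_summable[OF q t]]
  have "(\<lambda>n. \<Sum>k\<le>n. ?b k * ?e (n - k)) sums ((\<Sum>k. ?b k) * (1 / qpoch_inf t (of_real q)))"
    unfolding qexp_suminf[OF q t] .
  moreover have "(\<Sum>k\<le>n. ?b k * ?e (n - k)) = of_real (u n) * t ^ n" for n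
  proof -
    have "?b k * ?e (n - k) = of_real (b k * e (n - k)) * t ^ n" if "k \<le> n" for k
    proof -
      have "t ^ n = t ^ k * t ^ (n - k)" using that by (simp flip: power_add)
      then show ?thesis by (simp add: e_def)
    qed
    then show ?thesis by (simp add: ug g_def sum_distrib_right)
  qed
  moreover have "(\<Sum>k. ?b k) = phi11 (of_real (- y)) 0 (of_real q) (of_real A * t)"
    unfolding phi11_def qpoch_of_real qpoch_zero b_def
    by (intro suminf_cong) (simp add: power_mult_distrib)
  ultimately show ?thesis by (simp add: mult.commute)
qed

section \<open>The eigenvalue equation\<close>

text \<open>Extracting the negative half powers of \<open>q\<close> exposes 1 - q^c, the kind of
  factor occurring in q-shifted factorials.\<close>

lemma qnum_eq:
  assumes "0 < q" "q < 1"
  shows "qnum q c = q powr ((1 - c) / 2) * (1 - q powr c) / (1 - q)"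
proof -
  have "q powr (c / 2) - q powr (- c / 2) = - (q powr (- c / 2)) * (1 - q powr c)"
    using assms by (simp add: algebra_simps flip: powr_add)
  moreover have "q powr (1 / 2) - q powr (- 1 / 2) = - (q powr (- 1 / 2)) * (1 - q)"
    using assms powr_add[of q "-1/2" 1] by (simp add: algebra_simps)
  moreover have "q powr (- c / 2) = q powr ((1 - c) / 2) * q powr (- 1 / 2)"
    by (simp add: diff_divide_distrib flip: powr_add)
  ultimately show ?thesis using assms unfolding qnum_def by simp
qed

lemma sqrt_qnum_mult:
  fixes m :: nat
  assumes "0 < q" "q < 1" "0 < l"
  shows "sqrt (qnum q (2 * l + real m) * qnum q (real m + 1)) =
    q powr (1 / 4 - l / 2 - real m / 2) / (1 - q)
      * (sqrt (1 - q powr (2 * l) * q ^ m) * sqrt (1 - q * q ^ m))"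
proof -
  have p: "q powr (2 * l + real m) = q powr (2 * l) * q ^ m" "q powr (real m + 1) = q * q ^ m"
    using assms by (simp_all add: powr_add powr_realpow)
  \<comment> \<open>The two prefactors combine to a perfect square, so no root of a power of
    \<open>q\<close> is left.\<close>
  have e: "q powr ((1 - (2 * l + real m)) / 2) * q powr ((1 - (real m + 1)) / 2) =
      (q powr (1 / 4 - l / 2 - real m / 2))\<^sup>2"
    unfolding power2_eq_square powr_add[symmetric] by (rule arg_cong[where f = "(powr) q"]) (simp add: field_simps)
  have "qnum q (2 * l + real m) * qnum q (real m + 1) =
      (q powr ((1 - (2 * l + real m)) / 2) * q powr ((1 - (real m + 1)) / 2)) / (1 - q)\<^sup>2
        * ((1 - q powr (2 * l) * q ^ m) * (1 - q * q ^ m))"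
    unfolding qnum_eq[OF assms(1,2)] p by (simp add: power2_eq_square)
  then show ?thesis unfolding e power_divide[symmetric]
    using assms by (simp add: real_sqrt_mult)
qed

text \<open>The ratio of consecutive normalization constants, in product form; it carries matrix
  entries from the orthonormal basis over to monomials.\<close>

lemma basis_const_Suc:
  assumes "0 < q" "q < 1" "0 < l"
  shows "basis_const q l (Suc m) * sqrt (1 - q * q ^ m) =
    q powr ((1 - 2 * l) / 4) * sqrt (1 - q powr (2 * l) * q ^ m) * basis_const q l m"
proof -
  have "1 - q * q ^ m > 0" using power_Suc_less_one[of q m] assms by simp
  then have "sqrt (1 - q * q ^ m) \<noteq> 0" by simp
  moreover have "q powr ((1 - 2 * l) * real (Suc m) / 4) =
      q powr ((1 - 2 * l) / 4) * q powr ((1 - 2 * l) * real m / 4)"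
    unfolding powr_add[symmetric] by (rule arg_cong[where f = "(powr) q"]) (simp add: field_simps)
  ultimately show ?thesis
    unfolding basis_const_def qpoch_Suc real_sqrt_mult real_sqrt_divide by simp
qed

section \<open>The operators on coefficients of monomials\<close>

lemma qJ0_nth:
  assumes "0 < q" "q < 1" "0 < l"
  shows "fps_nth (qJ0 q l c \<phi>) n = of_real (q powr (c * (l + real n))) * fps_nth \<phi> n"
  using basis_const_pos[OF assms, of n]
  by (simp add: qJ0_def basis_series_def basis_coeff_def)

lemma J_plus_nth_0: "fps_nth (J_plus q l \<phi>) 0 = 0"
  by (simp add: J_plus_def basis_series_def)

text \<open>Passing to monomials removes the square roots: the change of normalization cancels the
  root of 1 - q^(m+1) and squares that of 1 - q^(2l+m).\<close>

lemma J_plus_nth_Suc: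
  assumes q: "0 < q" "q < 1" "0 < l"
  shows "fps_nth (J_plus q l \<phi>) (Suc m) =
    of_real (q powr (1 / 2 - l - real m / 2) * (1 - q powr (2 * l) * q ^ m) / (1 - q)) * fps_nth \<phi> m"
proof -
  let ?a = "sqrt (1 - q powr (2 * l) * q ^ m)" and ?b = "sqrt (1 - q * q ^ m)"
  have b0: "0 \<le> 1 - q powr (2 * l) * q ^ m"
    using mult_le_one[of "q powr (2 * l)" "q ^ m"] powr_less_mono2[of "2 * l" q 1] q
    by (simp add: power_le_one)
  have "sqrt (qnum q (2 * l + real m) * qnum q (real m + 1)) * basis_const q l (Suc m)
      = q powr (1 / 4 - l / 2 - real m / 2) / (1 - q) * ?a * (basis_const q l (Suc m) * ?b)"
    unfolding sqrt_qnum_mult[OF q] by simp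
  also have "\<dots> = q powr (1 / 4 - l / 2 - real m / 2) * q powr ((1 - 2 * l) / 4) / (1 - q)
      * (?a * ?a) * basis_const q l m"
    unfolding basis_const_Suc[OF q] by simp
  also have "?a * ?a = 1 - q powr (2 * l) * q ^ m" using b0 by simp
  also have "q powr (1 / 4 - l / 2 - real m / 2) * q powr ((1 - 2 * l) / 4) = q powr (1 / 2 - l - real m / 2)"
    unfolding powr_add[symmetric] by (rule arg_cong[where f = "(powr) q"]) (simp add: field_simps)
  finally have r: "sqrt (qnum q (2 * l + real m) * qnum q (real m + 1)) * basis_const q l (Suc m) / basis_const q l m
    = q powr (1 / 2 - l - real m / 2) * (1 - q powr (2 * l) * q ^ m) / (1 - q)"
    using basis_const_pos[OF q, of m] by simp
  show ?thesis
    unfolding J_plus_def basis_series_def basis_coeff_def fps_nth_Abs_fps nat.case r[symmetric] by simp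
qed

text \<open>Here the roles are exchanged: the root of 1 - q^(m+1) is squared and the other one is
  absorbed by the normalization.\<close>

lemma J_minus_nth:
  assumes q: "0 < q" "q < 1" "0 < l"
  shows "fps_nth (J_minus q l \<phi>) m =
    of_real (q powr (- real m / 2) * (1 - q * q ^ m) / (1 - q)) * fps_nth \<phi> (Suc m)"
proof -
  let ?a = "sqrt (1 - q powr (2 * l) * q ^ m)" and ?b = "sqrt (1 - q * q ^ m)"
  have b0: "0 \<le> 1 - q * q ^ m" using power_Suc_less_one[of q m] q by simp
  have e: "q powr (1 / 4 - l / 2 - real m / 2) = q powr (- real m / 2) * q powr ((1 - 2 * l) / 4)"
    unfolding powr_add[symmetric] by (rule arg_cong[where f = "(powr) q"]) (simp add: field_simps)
  have "sqrt (qnum q (2 * l + real m) * qnum q (real m + 1)) * basis_const q l m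
      = q powr (- real m / 2) / (1 - q) * ?b * (q powr ((1 - 2 * l) / 4) * ?a * basis_const q l m)"
    unfolding sqrt_qnum_mult[OF q] e by simp
  also have "\<dots> = q powr (- real m / 2) / (1 - q) * (?b * ?b) * basis_const q l (Suc m)"
    unfolding basis_const_Suc[OF q, symmetric] by simp
  also have "?b * ?b = 1 - q * q ^ m" using b0 by simp
  finally have r: "sqrt (qnum q (2 * l + real m) * qnum q (real m + 1)) * basis_const q l m / basis_const q l (Suc m)
    = q powr (- real m / 2) * (1 - q * q ^ m) / (1 - q)"
    using basis_const_pos[OF q, of "Suc m"] by simp
  have s: "sqrt (qnum q (2 * l + real (Suc m) - 1) * qnum q (real (Suc m))) =
      sqrt (qnum q (2 * l + real m) * qnum q (real m + 1))" by (simp add: add_ac)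
  show ?thesis
    unfolding J_minus_def basis_series_def basis_coeff_def fps_nth_Abs_fps s r[symmetric] by simp
qed

text \<open>After rescaling by powers of \<open>\<tau>\<close>, the n-th coefficient of the
  eigenvalue equation is the recurrence at \<open>n\<close> times a factor \<open>K n\<close> that
  is never 0, which gives both directions.\<close>

lemma I3_eigen_iff_qlag_rec:
  fixes q l y :: real and \<phi> :: "complex fps"
  defines "\<tau> \<equiv> q powr ((3 - 2 * l) / 4)"
  assumes q: "0 < q" "q < 1" "0 < l"
  shows "I3 q l \<phi> = fps_const (of_real (y / (2 * (1 - q)))) * \<phi> \<longleftrightarrow>
    qlag_rec (of_real q) (of_real (q powr (2 * l))) (of_real y) (\<lambda>n. fps_nth \<phi> n / of_real \<tau> ^ n)"
proof -
  define A where "A = q powr (2 * l)"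
  define u where "u n = fps_nth \<phi> n / of_real \<tau> ^ n" for n
  have tau: "\<tau> > 0" using q by (simp add: \<tau>_def)
  have phi: "fps_nth \<phi> n = of_real (\<tau> ^ n) * u n" for n
    using tau by (simp add: u_def)
  have tau_pow: "\<tau> ^ n = q powr ((3 - 2 * l) / 4 * real n)" for n
    using q tau powr_realpow[of \<tau> n] by (simp add: \<tau>_def powr_powr)
  \<comment> \<open>The value of \<open>\<tau>\<close> is the one for which the term from
    \<open>J_minus\<close> carries the same power of \<open>q\<close> as the term from q^(-2 J0);
    that common factor is \<open>K n\<close>.\<close>
  define K where "K n = - (q powr (- 2 * (l + real n))) * \<tau> ^ n / (2 * (1 - q))" for n
  have K0: "K n \<noteq> 0" for n using q tau by (simp add: K_def)
  have minus: "- (1 / 2) * (q powr (- 3 / 4 * (l + real n)) * (q powr (- real n / 2) * (1 - q * q ^ n) / (1 - q)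
      * q powr (- 3 / 4 * (l + real (Suc n))))) * \<tau> ^ Suc n = K n * (1 - q * q ^ n)" for n
  proof -
    have e: "q powr (- 3 / 4 * (l + real n)) * q powr (- real n / 2) * q powr (- 3 / 4 * (l + real (Suc n))) * \<tau> ^ Suc n
      = q powr (- 2 * (l + real n)) * \<tau> ^ n"
      unfolding tau_pow powr_add[symmetric] by (rule arg_cong[where f = "(powr) q"]) (simp add: field_simps)
    have g: "- (1 / 2) * (a * (b * p / s * c)) * t = - (1 / 2) * (a * b * c * t) * p / s" for a b c p s t :: real
      by simp
    show ?thesis unfolding g e K_def by simp
  qed
  \<comment> \<open>Relative to \<open>K (Suc m)\<close> one power of \<open>q\<close> is left over;
    it is the factor \<open>q\<close> in the last term of the recurrence.\<close>
  have plus: "- (1 / 2) * (q powr (- 3 / 4 * (l + real (Suc m))) * (q powr (1 / 2 - l - real m / 2) * (1 - A * q ^ m) / (1 - q)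
      * q powr (- 3 / 4 * (l + real m)))) * \<tau> ^ m = K (Suc m) * (q * (1 - A * q ^ m))" for m
  proof -
    have e: "q powr (- 3 / 4 * (l + real (Suc m))) * q powr (1 / 2 - l - real m / 2) * q powr (- 3 / 4 * (l + real m)) * \<tau> ^ m
      = q powr (- 2 * (l + real (Suc m))) * \<tau> ^ Suc m * q powr 1"
      unfolding tau_pow powr_add[symmetric] by (rule arg_cong[where f = "(powr) q"]) (simp add: field_simps)
    have g: "- (1 / 2) * (a * (b * p / s * c)) * t = - (1 / 2) * (a * b * c * t) * p / s" for a b c p s t :: real
      by simp
    show ?thesis unfolding g e K_def using q by simp
  qed
  have d2: "(1 + q) / (2 * (1 - q)) * q powr (- 2 * (l + real n)) * \<tau> ^ n = - K n * (1 + q)" for n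
    by (simp add: K_def)
  have d1: "(q powr l + q powr (1 - l)) / (2 * (1 - q)) * q powr (- 1 * (l + real n)) * \<tau> ^ n
      = - K n * (A * q ^ n + q ^ Suc n)" for n
  proof -
    have "q powr l * q powr (- 1 * (l + real n)) = q powr (- 2 * (l + real n)) * (A * q ^ n)"
      "q powr (1 - l) * q powr (- 1 * (l + real n)) = q powr (- 2 * (l + real n)) * q ^ Suc n"
      unfolding A_def using q by (simp_all add: field_simps flip: powr_add powr_realpow power_Suc)
    then have "(q powr l + q powr (1 - l)) * q powr (- 1 * (l + real n)) =
        q powr (- 2 * (l + real n)) * (A * q ^ n + q ^ Suc n)"
      by (simp only: ring_distribs)
    then show ?thesis unfolding K_def by (simp add: field_simps)
  qed
  \<comment> \<open>The eigenvalue term has no power of q^(l+n) of its own, so taking out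
    \<open>K n\<close> leaves q^(2(l+n)), that is, A q^(2n).\<close>
  have d0: "y / (2 * (1 - q)) * \<tau> ^ n = - K n * (y * A * q ^ (2 * n))" for n
  proof -
    have "q powr (- 2 * (l + real n)) * (A * q ^ (2 * n)) = 1"
      unfolding A_def using q by (simp add: field_simps flip: powr_add powr_realpow)
    then show ?thesis unfolding K_def by (simp add: field_simps)
  qed
  have half: "fps_nth (- fps_const (1 / 2) * f) n = of_real (- (1 / 2)) * fps_nth f n" for f :: "complex fps" and n
    by simp
  have ext: "fps_nth (I3 q l \<phi>) n - fps_nth (fps_const (of_real (y / (2 * (1 - q)))) * \<phi>) n =
     of_real (K n) * ((1 - of_real q ^ Suc n) * u (Suc n) -
     ((1 + of_real q - of_real q ^ Suc n - of_real A * of_real q ^ n - of_real y * of_real A * of_real q ^ (2 * n)) * u n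
       - (case n of 0 \<Rightarrow> 0 | Suc m \<Rightarrow> of_real q * (1 - of_real A * of_real q ^ m) * u m)))" for n
  proof -
    define X where "X = (case n of 0 \<Rightarrow> 0 | Suc m \<Rightarrow> of_real q * (1 - of_real A * of_real q ^ m) * u m)"
    have P: "of_real (- (1 / 2)) * (of_real (q powr (- 3 / 4 * (l + real n))) *
        fps_nth (J_plus q l (qJ0 q l (- 3 / 4) \<phi>)) n) = of_real (K n) * X"
    proof (cases n)
      case (Suc m)
      have "of_real (- (1 / 2)) * (of_real (q powr (- 3 / 4 * (l + real n))) *
          fps_nth (J_plus q l (qJ0 q l (- 3 / 4) \<phi>)) n) = of_real (- (1 / 2) * (q powr (- 3 / 4 * (l + real (Suc m))) *
          (q powr (1 / 2 - l - real m / 2) * (1 - A * q ^ m) / (1 - q) * q powr (- 3 / 4 * (l + real m)))) * \<tau> ^ m) * u m"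
        unfolding Suc J_plus_nth_Suc[OF q] qJ0_nth[OF q] phi A_def[symmetric]
        by (simp only: of_real_mult mult.assoc)
      then show ?thesis unfolding plus by (simp add: X_def Suc)
    qed (simp add: J_plus_nth_0 X_def)
    have M: "of_real (- (1 / 2)) * (of_real (q powr (- 3 / 4 * (l + real n))) *
        fps_nth (J_minus q l (qJ0 q l (- 3 / 4) \<phi>)) n) = of_real (K n * (1 - q * q ^ n)) * u (Suc n)"
      unfolding minus[symmetric] J_minus_nth[OF q] qJ0_nth[OF q] phi
      by (simp only: of_real_mult mult.assoc)
    have D2: "of_real ((1 + q) / (2 * (1 - q))) * (of_real (q powr (- 2 * (l + real n))) * fps_nth \<phi> n) =
        of_real (- K n * (1 + q)) * u n"
      unfolding d2[symmetric] phi by (simp only: of_real_mult mult.assoc)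
    have D1: "of_real ((q powr l + q powr (1 - l)) / (2 * (1 - q))) * (of_real (q powr (- 1 * (l + real n))) * fps_nth \<phi> n) =
        of_real (- K n * (A * q ^ n + q ^ Suc n)) * u n"
      unfolding d1[symmetric] phi by (simp only: of_real_mult mult.assoc)
    have D0: "of_real (y / (2 * (1 - q))) * fps_nth \<phi> n = of_real (- K n * (y * A * q ^ (2 * n))) * u n"
      unfolding d0[symmetric] phi by (simp only: of_real_mult mult.assoc)
    have dist: "a * (b * (f + g)) = a * (b * f) + a * (b * g)" for a b f g :: complex
      by (simp add: distrib_left)
    show ?thesis
      unfolding X_def[symmetric] I3_def fps_sub_nth fps_add_nth half fps_mult_left_const_nth qJ0_nth[OF q]
        dist P M D2 D1 D0
      by (simp add: algebra_simps)
  qed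
  have "I3 q l \<phi> = fps_const (of_real (y / (2 * (1 - q)))) * \<phi> \<longleftrightarrow>
      (\<forall>n. fps_nth (I3 q l \<phi>) n - fps_nth (fps_const (of_real (y / (2 * (1 - q)))) * \<phi>) n = 0)"
    by (simp only: fps_eq_iff right_minus_eq)
  then show ?thesis
    unfolding ext qlag_rec_def u_def[symmetric] A_def[symmetric] using K0
    by (simp only: mult_eq_0_iff of_real_eq_0_iff right_minus_eq) simp
qed

text \<open>The square roots cancel and q^(n/2) combines with q^((1-2l)n/4). Hence rescaling the
  coefficients of \<open>zeta\<close> leaves exactly the q-Laguerre polynomials.\<close>

lemma P_coeff_mult_basis_const:
  assumes q: "0 < q" "q < 1" "0 < l"
  shows "P_coeff q l n lam * basis_const q l n =
    (q powr ((3 - 2 * l) / 4)) ^ n * qLaguerre (2 * l - 1) n (2 * (1 - q) * lam) q"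
proof -
  have "q powr (2 * l) < 1" using q powr_less_mono2[of "2 * l" q 1] by simp
  then have nz: "sqrt (qpoch (q powr (2 * l)) q n) \<noteq> 0" "sqrt (qpoch q q n) \<noteq> 0"
    using qpoch_pos[of q "q powr (2 * l)" n] qpoch_pos[of q q n] q by simp_all
  have "(q powr ((3 - 2 * l) / 4)) ^ n = q powr ((3 - 2 * l) / 4 * real n)"
    using q powr_realpow[of "q powr ((3 - 2 * l) / 4)" n] by (simp add: powr_powr)
  also have "\<dots> = q powr (real n / 2) * q powr ((1 - 2 * l) * real n / 4)"
    unfolding powr_add[symmetric] by (rule arg_cong[where f = "(powr) q"]) (simp add: field_simps)
  finally show ?thesis
    unfolding P_coeff_def basis_const_def real_sqrt_divide using nz by simp
qed

section \<open>The eigenfunctions and their closed form\<close>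

theorem mainTheorem6:
  fixes q l \<nu> lam :: real
  assumes "0 < q" and "q < 1" and "0 < l" and "lam = \<nu> / (2 * (1 - q))"
  shows
    "(\<forall>\<phi>. (\<phi> \<noteq> 0 \<and> I3 q l \<phi> = fps_const (of_real lam) * \<phi>)
          \<longleftrightarrow> (\<exists>c. c \<noteq> 0 \<and> \<phi> = fps_const c * zeta q l lam))
     \<and> fps_nth (zeta q l lam) 0 = 1
     \<and> (\<forall>x::complex. norm (of_real (q powr ((3 - 2 * l) / 4)) * x) < 1 \<longrightarrow>
          (\<lambda>n. of_real (P_coeff q l n lam) * basis_fun q l n x) sums
            (1 / qpoch_inf (of_real (q powr ((3 - 2 * l) / 4)) * x) (of_real q)
               * phi11 (of_real (- \<nu>)) 0 (of_real q) (of_real (q powr (3 * (1 + 2 * l) / 4)) * x)))"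
proof -
  define \<tau> where "\<tau> = q powr ((3 - 2 * l) / 4)"
  define A where "A = q powr (2 * l)"
  define u where "u n = qLaguerre (2 * l - 1) n \<nu> q" for n
  note q = assms(1,2)
  have tau: "\<tau> > 0" using q by (simp add: \<tau>_def)
  have nu: "2 * (1 - q) * lam = \<nu>" using assms by simp
  have u0: "u 0 = 1" using q by (simp add: u_def qLaguerre_def)
  have u_rec: "qlag_rec q A \<nu> u"
    using qLaguerre_rec[OF q, of "2 * l - 1" \<nu>] assms(3) by (simp add: u_def[abs_def] A_def)
  have Pc: "P_coeff q l n lam * basis_const q l n = \<tau> ^ n * u n" for n
    unfolding P_coeff_mult_basis_const[OF assms(1-3)] nu \<tau>_def u_def ..
  have zeta_nth: "fps_nth (zeta q l lam) n = of_real (\<tau> ^ n) * of_real (u n)" for n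
    using Pc[of n] by (simp add: zeta_def basis_series_def flip: of_real_mult of_real_power)
  have "complex_of_real q ^ Suc n \<noteq> 1" for n
    unfolding of_real_power[symmetric] of_real_eq_1_iff using power_Suc_less_one[of q n] q by simp
  note unique = qlag_rec_unique[OF _ qlag_rec_of_real[OF u_rec, where 'a = complex] _ this]
  have eigen: "I3 q l \<phi> = fps_const (of_real lam) * \<phi> \<longleftrightarrow>
      (\<exists>c. \<phi> = fps_const c * zeta q l lam)" (is "?L \<longleftrightarrow> ?R") for \<phi>
  proof -
    let ?v = "\<lambda>n. fps_nth \<phi> n / of_real \<tau> ^ n"
    have iff: "?L \<longleftrightarrow> qlag_rec (of_real q) (of_real A) (of_real \<nu>) ?v"
      unfolding \<tau>_def A_def assms(4) by (rule I3_eigen_iff_qlag_rec[OF assms(1-3)])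
    show ?thesis
    proof
      assume ?L
      then have r: "qlag_rec (of_real q) (of_real A) (of_real \<nu>) ?v" unfolding iff .
      have v: "?v n = ?v 0 * of_real (u n)" for n
        using unique[OF r, of n] u0 by simp
      have "fps_nth \<phi> n = fps_nth \<phi> 0 * fps_nth (zeta q l lam) n" for n
        using v[of n] tau by (simp add: zeta_nth field_simps)
      then have "\<phi> = fps_const (fps_nth \<phi> 0) * zeta q l lam"
        unfolding fps_eq_iff fps_mult_left_const_nth by blast
      then show ?R by blast
    next
      assume ?R
      then obtain c where "\<phi> = fps_const c * zeta q l lam" by blast
      then have v: "?v = (\<lambda>n. c * of_real (u n))" using tau by (simp add: fun_eq_iff zeta_nth)
      show ?L unfolding iff v by (intro qlag_rec_scale qlag_rec_of_real u_rec)
    qed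
  qed
  have zeta_0: "fps_nth (zeta q l lam) 0 = 1" by (simp add: zeta_nth u0)
  have "(\<lambda>n. of_real (P_coeff q l n lam) * basis_fun q l n x) sums
      (1 / qpoch_inf (of_real \<tau> * x) (of_real q)
         * phi11 (of_real (- \<nu>)) 0 (of_real q) (of_real (q powr (3 * (1 + 2 * l) / 4)) * x))"
    if "norm (of_real \<tau> * x) < 1" for x :: complex
  proof -
    \<comment> \<open>With t = \<tau> x, this identifies the argument of the 1phi1 as A t.\<close>
    have "A * \<tau> = q powr (3 * (1 + 2 * l) / 4)"
      unfolding A_def \<tau>_def powr_add[symmetric]
      by (rule arg_cong[where f = "(powr) q"]) (simp add: field_simps)
    then have z: "of_real (q powr (3 * (1 + 2 * l) / 4)) * x = of_real A * (of_real \<tau> * x)"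
      by (simp flip: of_real_mult)
    have "of_real (P_coeff q l n lam) * basis_fun q l n x = of_real (u n) * (of_real \<tau> * x) ^ n" for n
    proof -
      have "of_real (P_coeff q l n lam) * basis_fun q l n x =
          of_real (P_coeff q l n lam * basis_const q l n) * x ^ n"
        by (simp add: basis_fun_def)
      then show ?thesis unfolding Pc by (simp add: power_mult_distrib)
    qed
    then show ?thesis
      unfolding z using qlag_rec_generating_function[OF q u_rec u0 that] by (simp only:)
  qed
  \<comment> \<open>As \<open>zeta\<close> is nonzero, a multiple of it is nonzero exactly when the
    constant is.\<close>
  moreover have "zeta q l lam \<noteq> 0" using zeta_0 by auto
  then have "\<phi> \<noteq> 0 \<and> I3 q l \<phi> = fps_const (of_real lam) * \<phi> \<longleftrightarrow>
      (\<exists>c. c \<noteq> 0 \<and> \<phi> = fps_const c * zeta q l lam)" for \<phi>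
    unfolding eigen by (metis fps_const_eq_0_iff mult_eq_0_iff)
  ultimately show ?thesis
    unfolding \<tau>_def using zeta_0 by blast
qed

end
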